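(* There are infinitely many (pairwise non-isomorphic) finite supersoluble groups that are generative Ingleton violators. Specifically, for infinitely many primes $p$ there is a semidirect product $p^{1+2}_+\rtimes C_{p-1}$ of the extraspecial group $p^{1+2}_+$ by a cyclic group of order $p-1$ that is supersoluble and is a generative Ingleton violator.
   Context: For subgroups $H_1,H_2,H_3,H_4$ of a finite group $G$, write $H_{12}=H_1\cap H_2$, $H_{123}=H_1\cap H_2\cap H_3$, and so on. The quadruple $(H_1,H_2,H_3,H_4)$ is an Ingleton offender if the inequality $|H_1|\cdot|H_2|\cdot|H_{34}|\cdot|H_{123}|\cdot|H_{124}|\geq |H_{12}|\cdot|H_{13}|\cdot|H_{14}|\cdot|H_{23}|\cdot|H_{24}|$ is not satisfied. It is a generative Ingleton offender if in addition $G$ is generated by $H_1,H_2,H_3,H_4$. A finite group is a generative Ingleton violator if it contains a generative Ingleton offender. A finite group $G$ is supersoluble if it has a chain of subgroups $1=G_0\leq G_1\leq\cdots\leq G_r=G$ with each $G_i$ normal in $G$ and each $G_i/G_{i-1}$ cyclic. For an odd prime $p$, $p^{1+2}_+$ denotes the extraspecial group of order $p^3$ and exponent $p$. *)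

theory Defs
  imports "HOL-Algebra.Algebra" "HOL-Computational_Algebra.Primes"
begin

definition supersoluble :: "('a, 'b) monoid_scheme \<Rightarrow> bool" where
  "supersoluble G \<longleftrightarrow> group G \<and> finite (carrier G) \<and>
    (\<exists>(K :: nat \<Rightarrow> 'a set) r.
      K 0 = {\<one>\<^bsub>G\<^esub>} \<and> K r = carrier G \<and>
      (\<forall>i\<le>r. K i \<lhd> G) \<and>
      (\<forall>i<r. K i \<subseteq> K (Suc i) \<and> cyclic_group ((G\<lparr>carrier := K (Suc i)\<rparr>) Mod K i)))"

definition ingleton_offender ::
    "('a, 'b) monoid_scheme \<Rightarrow> 'a set \<Rightarrow> 'a set \<Rightarrow> 'a set \<Rightarrow> 'a set \<Rightarrow> bool" where
  "ingleton_offender G H1 H2 H3 H4 \<longleftrightarrow>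
    subgroup H1 G \<and> subgroup H2 G \<and> subgroup H3 G \<and> subgroup H4 G \<and>
    \<not> (card H1 * card H2 * card (H3 \<inter> H4) * card (H1 \<inter> H2 \<inter> H3) * card (H1 \<inter> H2 \<inter> H4)
        \<ge> card (H1 \<inter> H2) * card (H1 \<inter> H3) * card (H1 \<inter> H4) * card (H2 \<inter> H3) * card (H2 \<inter> H4))"

definition generative_ingleton_offender ::
    "('a, 'b) monoid_scheme \<Rightarrow> 'a set \<Rightarrow> 'a set \<Rightarrow> 'a set \<Rightarrow> 'a set \<Rightarrow> bool" where
  "generative_ingleton_offender G H1 H2 H3 H4 \<longleftrightarrow>
    ingleton_offender G H1 H2 H3 H4 \<and> generate G (H1 \<union> H2 \<union> H3 \<union> H4) = carrier G"

definition generative_ingleton_violator :: "('a, 'b) monoid_scheme \<Rightarrow> bool" where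
  "generative_ingleton_violator G \<longleftrightarrow> group G \<and> finite (carrier G) \<and>
    (\<exists>H1 H2 H3 H4. generative_ingleton_offender G H1 H2 H3 H4)"

definition group_center :: "('a, 'b) monoid_scheme \<Rightarrow> 'a set" where
  "group_center G = {z \<in> carrier G. \<forall>x \<in> carrier G. z \<otimes>\<^bsub>G\<^esub> x = x \<otimes>\<^bsub>G\<^esub> z}"

definition elementary_abelian :: "nat \<Rightarrow> ('a, 'b) monoid_scheme \<Rightarrow> bool" where
  "elementary_abelian p G \<longleftrightarrow> comm_group G \<and> (\<forall>x \<in> carrier G. x [^]\<^bsub>G\<^esub> p = \<one>\<^bsub>G\<^esub>)"

text \<open>A \<open>p\<close>-group is extraspecial if its centre has order \<open>p\<close> and its central quotient is
  a nontrivial elementary abelian \<open>p\<close>-group.\<close>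

definition extraspecial :: "nat \<Rightarrow> ('a, 'b) monoid_scheme \<Rightarrow> bool" where
  "extraspecial p G \<longleftrightarrow> group G \<and> (\<exists>n. order G = p ^ n) \<and>
    card (group_center G) = p \<and>
    elementary_abelian p (G Mod group_center G) \<and> \<not> trivial_group (G Mod group_center G)"

text \<open>Only meaningful for groups of finite exponent, in particular for finite groups.\<close>

definition group_exponent :: "('a, 'b) monoid_scheme \<Rightarrow> nat" where
  "group_exponent G = (LEAST n. 0 < n \<and> (\<forall>x \<in> carrier G. x [^]\<^bsub>G\<^esub> n = \<one>\<^bsub>G\<^esub>))"

text \<open>For an odd prime \<open>p\<close> this predicate determines the group \<open>p\<^sup>1\<^sup>+\<^sup>2\<^sub>+\<close> up to
  isomorphism.\<close>

definition extraspecial_plus :: "nat \<Rightarrow> ('a, 'b) monoid_scheme \<Rightarrow> bool" where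
  "extraspecial_plus p P \<longleftrightarrow> extraspecial p P \<and> order P = p ^ 3 \<and> group_exponent P = p"

text \<open>The action is a homomorphism from \<open>H\<close> to the library group \<^const>\<open>AutoGroup\<close> of
  automorphisms of \<open>N\<close>; see the assumption of the lemma below.\<close>

definition semidirect_product ::
    "('a, 'c) monoid_scheme \<Rightarrow> ('b, 'd) monoid_scheme \<Rightarrow> ('b \<Rightarrow> 'a \<Rightarrow> 'a) \<Rightarrow> ('a \<times> 'b) monoid" where
  "semidirect_product N H \<phi> =
    \<lparr>carrier = carrier N \<times> carrier H,
     monoid.mult = (\<lambda>(n, h) (n', h'). (n \<otimes>\<^bsub>N\<^esub> \<phi> h n', h \<otimes>\<^bsub>H\<^esub> h')),
     one = (\<one>\<^bsub>N\<^esub>, \<one>\<^bsub>H\<^esub>)\<rparr>"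

lemma group_semidirect_product:
  assumes N: "group N" and H: "group H" and \<phi>: "\<phi> \<in> hom H (AutoGroup N)"
  shows "group (semidirect_product N H \<phi>)"
proof -
  interpret N: group N by fact
  interpret H: group H by fact
  have A: "group (AutoGroup N)" by (rule N.AutoGroup)
  interpret h: group_hom H "AutoGroup N" \<phi>
    using A \<phi> by (simp add: group_hom_def group_hom_axioms_def H)
  have aut: "\<phi> x \<in> hom N N" "\<phi> x \<in> Bij (carrier N)" if "x \<in> carrier H" for x
    using h.hom_closed[OF that] by (auto simp: AutoGroup_def auto_def)
  have cl: "\<phi> x a \<in> carrier N" if "x \<in> carrier H" "a \<in> carrier N" for x a
    using aut(1)[OF that(1)] that(2) by (auto simp: hom_def)
  have m: "\<phi> x (a \<otimes>\<^bsub>N\<^esub> b) = \<phi> x a \<otimes>\<^bsub>N\<^esub> \<phi> x b"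
    if "x \<in> carrier H" "a \<in> carrier N" "b \<in> carrier N" for x a b
    using aut(1)[OF that(1)] that(2,3) by (auto simp: hom_def)
  have c: "\<phi> (x \<otimes>\<^bsub>H\<^esub> y) a = \<phi> x (\<phi> y a)"
    if "x \<in> carrier H" "y \<in> carrier H" "a \<in> carrier N" for x y a
    using h.hom_mult[OF that(1,2)] that(3) aut(2)[OF that(1)] aut(2)[OF that(2)]
    by (simp add: AutoGroup_def BijGroup_def compose_def)
  have one: "\<phi> \<one>\<^bsub>H\<^esub> a = a" if "a \<in> carrier N" for a
    using h.hom_one that by (simp add: AutoGroup_def BijGroup_def)
  show ?thesis
  proof (rule groupI, goal_cases)
    case (5 x)
    then obtain n k where x: "x = (n, k)" "n \<in> carrier N" "k \<in> carrier H"
      by (auto simp: semidirect_product_def)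
    define y where "y = (\<phi> (inv\<^bsub>H\<^esub> k) (inv\<^bsub>N\<^esub> n), inv\<^bsub>H\<^esub> k)"
    have "\<phi> (inv\<^bsub>H\<^esub> k) (inv\<^bsub>N\<^esub> n) \<otimes>\<^bsub>N\<^esub> \<phi> (inv\<^bsub>H\<^esub> k) n = \<phi> (inv\<^bsub>H\<^esub> k) (\<one>\<^bsub>N\<^esub>)"
      using m[of "inv\<^bsub>H\<^esub> k" "inv\<^bsub>N\<^esub> n" n] x
      by (simp del: h.hom_inv)
    also have "\<dots> = \<one>\<^bsub>N\<^esub>"
      using aut(1)[of "inv\<^bsub>H\<^esub> k"] x by (simp add: N hom_one del: h.hom_inv)
    finally show ?case
      using x by (intro bexI[of _ y]) (auto simp: semidirect_product_def y_def cl simp del: h.hom_inv)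
  qed (auto simp: semidirect_product_def cl m c one N.m_assoc H.m_assoc simp del: h.hom_one h.hom_mult)
qed

end

theory Submission
  imports Defs "HOL-Number_Theory.Residue_Primitive_Roots"
begin

text \<open>
  Let \<open>p \<ge> 5\<close> be prime, let \<open>P\<close> be the Heisenberg group modulo \<open>p\<close>, with product
  \<open>(x,y,z)(x',y',z') = (x+x', y+y', z+z'+xy')\<close>, and let a generator of the cyclic group of order \<open>p-1\<close>
  act by \<open>(x,y,z) \<mapsto> (gx, gy, g\<^sup>2z)\<close> for a primitive root \<open>g\<close>. The semidirect product \<open>G\<close> is
  supersoluble because \<open>1 < Z < \<langle>X,Z\<rangle> < P < G\<close>, with \<open>Z\<close> the centre of \<open>P\<close> and \<open>X\<close> generated by
  \<open>(1,0,0)\<close>, is a normal series with cyclic factors; normality holds since \<open>g\<close> acts on \<open>P/Z\<close> as a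
  scalar (\<open>supersoluble_G\<close>).

  \<open>G\<close> acts on \<open>P\<close> by affine maps. The point stabilisers are the conjugates of the cyclic complement,
  of order \<open>p-1\<close>. Call a left coset of a scaling-invariant subgroup of order \<open>p\<close> outside \<open>Z\<close> a line;
  the stabiliser of a line is isomorphic to the affine group of the field with \<open>p\<close> elements, of
  order \<open>p(p-1)\<close>. No three lines form a triangle, but quadrilaterals exist. Take for \<open>H1, H2\<close>
  and \<open>H3, H4\<close> the stabilisers of the two pairs of opposite sides of a quadrilateral. The
  four intersections of adjacent sides then have order at least \<open>p-1\<close>. An element common to three of
  the subgroups preserves two adjacent sides, hence fixes their common vertex, and then the third side
  forces it to be trivial. The quadrilateral is a trapezoid modulo \<open>Z\<close>: the sides of \<open>H3\<close> and \<open>H4\<close>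
  become parallel, which makes \<open>H3 \<inter> H4\<close> trivial, whereas the sides of \<open>H1\<close> and \<open>H2\<close> cross,
  and the involution of \<open>G\<close> at the crossing point, which centralises \<open>Z\<close>, lies in \<open>H1 \<inter> H2\<close>.

  So the left side of Ingleton's inequality is at most \<open>(p(p-1))\<^sup>2\<close> and the right side at least
  \<open>2(p-1)\<^sup>4\<close>, and \<open>p\<^sup>2 < 2(p-1)\<^sup>2\<close> for \<open>p \<ge> 5\<close> (\<open>offender\<close>). The subgroups generate \<open>G\<close> since
  \<open>H1\<close> and \<open>H3\<close> contain the cyclic complement and generators of \<open>P\<close> (\<open>generate_H\<close>). Different primes
  give groups of different orders \<open>p\<^sup>3(p-1)\<close>, hence non-isomorphic groups.
\<close>

section \<open>Criteria for supersoluble groups and for extraspecial groups of exponent p\<close>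

text \<open>In a finite group inverses are powers, so closure under inverses comes for free.\<close>
lemma (in group) finite_closed_imp_subgroup:
  assumes fin: "finite (carrier G)" and sub: "H \<subseteq> carrier G" and one: "\<one> \<in> H"
    and closed: "\<And>x y. x \<in> H \<Longrightarrow> y \<in> H \<Longrightarrow> x \<otimes> y \<in> H"
  shows "subgroup H G"
proof (rule subgroupI)
  show "H \<subseteq> carrier G" "H \<noteq> {}" using sub one by auto
  show "x \<otimes> y \<in> H" if "x \<in> H" "y \<in> H" for x y using that by (rule closed)
  show "inv x \<in> H" if x: "x \<in> H" for x
  proof -
    have xG: "x \<in> carrier G" using x sub by blast
    have pow: "x [^] n \<in> H" for n :: nat
      by (induction n) (auto simp: one x intro: closed)
    have "order G > 0" using fin order_gt_0_iff_finite by blast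
    then have "x [^] (order G - 1) \<otimes> x = \<one>"
      using pow_order_eq_1[OF xG] nat_pow_Suc[of x "order G - 1"] by simp
    then have "inv x = x [^] (order G - 1)"
      using xG by (intro inv_equality) auto
    then show ?thesis using pow by simp
  qed
qed

text \<open>The witness \<open>y\<close> is the conjugate \<open>g x g\<^sup>-\<^sup>1\<close>; naming it instead of computing it avoids
  inverses in concrete groups.\<close>
lemma (in group) normalI_commuting:
  assumes "subgroup N G"
    and "\<And>g x. g \<in> carrier G \<Longrightarrow> x \<in> N \<Longrightarrow> \<exists>y\<in>N. g \<otimes> x = y \<otimes> g"
  shows "N \<lhd> G"
  unfolding normal_inv_iff
proof (intro conjI ballI)
  fix g x assume g: "g \<in> carrier G" and x: "x \<in> N"
  from assms(2)[OF this] obtain y where y: "y \<in> N" "g \<otimes> x = y \<otimes> g" by blast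
  then show "g \<otimes> x \<otimes> inv g \<in> N"
    using g y(1) subgroup.mem_carrier[OF assms(1) y(1)] by (simp add: m_assoc)
qed fact

text \<open>Cyclicity of a factor is checked inside the group: the coset of \<open>x\<close> generates
  \<open>K (i + 1) / K i\<close> as soon as every element of \<open>K (i + 1)\<close> is a power of \<open>x\<close> up to a left
  factor in \<open>K i\<close>.\<close>
lemma (in group) supersolubleI:
  fixes K :: "nat \<Rightarrow> 'a set"
  assumes fin: "finite (carrier G)" and K0: "K 0 = {\<one>}" and Kr: "K r = carrier G"
    and norm: "\<And>i. i \<le> r \<Longrightarrow> K i \<lhd> G"
    and mono: "\<And>i. i < r \<Longrightarrow> K i \<subseteq> K (Suc i)"
    and gen: "\<And>i. i < r \<Longrightarrow> \<exists>x\<in>K (Suc i). \<forall>b\<in>K (Suc i). \<exists>a\<in>K i. \<exists>n::nat. b = a \<otimes> x [^] n"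
  shows "supersoluble G"
  unfolding supersoluble_def
proof (intro conjI exI allI impI)
  show "group G" by (rule is_group)
  show "finite (carrier G)" "K 0 = {\<one>}" "K r = carrier G" by fact+
  show "K i \<lhd> G" if "i \<le> r" for i using that by (rule norm)
  show "K i \<subseteq> K (Suc i)" if "i < r" for i using that by (rule mono)
  fix i assume i: "i < r"
  let ?B = "G\<lparr>carrier := K (Suc i)\<rparr>"
  have sB: "subgroup (K (Suc i)) G"
    using norm[of "Suc i"] i by (simp add: normal_imp_subgroup)
  interpret B: group ?B using sB by (rule subgroup.subgroup_is_group) (rule is_group)
  interpret A: normal "K i" ?B
    using normal_restrict_supergroup[OF sB norm[of i] mono[OF i]] i by simp
  interpret Q: group "?B Mod K i" by (rule A.factorgroup_is_group)
  obtain x where x: "x \<in> K (Suc i)"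
    and all: "\<And>b. b \<in> K (Suc i) \<Longrightarrow> \<exists>a\<in>K i. \<exists>n::nat. b = a \<otimes> x [^] n"
    using gen[OF i] by blast
  let ?x = "K i #>\<^bsub>?B\<^esub> x"
  have x': "?x \<in> carrier (?B Mod K i)" using x by (auto simp: carrier_FactGroup)
  have "carrier (?B Mod K i) = range (\<lambda>n::int. ?x [^]\<^bsub>?B Mod K i\<^esub> n)"
  proof
    show "range (\<lambda>n::int. ?x [^]\<^bsub>?B Mod K i\<^esub> n) \<subseteq> carrier (?B Mod K i)"
      using Q.int_pow_closed[OF x'] by blast
    show "carrier (?B Mod K i) \<subseteq> range (\<lambda>n::int. ?x [^]\<^bsub>?B Mod K i\<^esub> n)"
    proof
      fix C assume "C \<in> carrier (?B Mod K i)"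
      then obtain b where b: "b \<in> K (Suc i)" "C = K i #>\<^bsub>?B\<^esub> b"
        by (auto simp: carrier_FactGroup)
      obtain a n where an: "a \<in> K i" "b = a \<otimes>\<^bsub>?B\<^esub> x [^]\<^bsub>?B\<^esub> (n::nat)"
        using all[OF b(1)] by (auto simp: nat_pow_consistent[symmetric])
      have xn: "x [^]\<^bsub>?B\<^esub> n \<in> carrier ?B" using x by (intro B.nat_pow_closed) simp
      have "C = K i #>\<^bsub>?B\<^esub> (x [^]\<^bsub>?B\<^esub> n)"
        unfolding b(2) an(2)
        using an(1) xn A.subset by (metis B.coset_join2 A.is_subgroup A.mem_carrier B.coset_mult_assoc)
      also have "\<dots> = ?x [^]\<^bsub>?B Mod K i\<^esub> n"
        using x by (intro A.FactGroup_pow[symmetric]) simp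
      also have "\<dots> = ?x [^]\<^bsub>?B Mod K i\<^esub> (int n)" by (simp add: int_pow_int)
      finally show "C \<in> range (\<lambda>n::int. ?x [^]\<^bsub>?B Mod K i\<^esub> n)" by blast
    qed
  qed
  then show "cyclic_group (?B Mod K i)" unfolding Q.cyclic_group using x' by blast
qed

text \<open>Central commutators make the central quotient abelian, and the condition on \<open>p\<close>-th powers passes
  to it. The quotient is nontrivial since \<open>p < p\<^sup>3\<close>. A positive exponent \<open>n\<close> must be a multiple
  of \<open>p\<close>, as every nontrivial element has order \<open>p\<close>.\<close>
lemma (in group) extraspecial_plusI:
  assumes p: "Factorial_Ring.prime p"
    and order: "order G = p ^ 3" and center: "card (group_center G) = p"
    and comm: "\<And>x y. x \<in> carrier G \<Longrightarrow> y \<in> carrier G \<Longrightarrow> \<exists>z\<in>group_center G. x \<otimes> y = z \<otimes> (y \<otimes> x)"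
    and pow: "\<And>x. x \<in> carrier G \<Longrightarrow> x [^] p = \<one>"
  shows "extraspecial_plus p G"
proof -
  let ?Z = "group_center G"
  have p1: "1 < p" using p by (rule prime_gt_1_nat)
  have "finite (carrier G)" using order p1 order_gt_0_iff_finite by simp
  have "subgroup ?Z G"
  proof (rule finite_closed_imp_subgroup)
    fix x y assume x: "x \<in> ?Z" and y: "y \<in> ?Z"
    have "x \<otimes> y \<otimes> g = g \<otimes> (x \<otimes> y)" if g: "g \<in> carrier G" for g
    proof -
      have c: "x \<in> carrier G" "y \<in> carrier G" "x \<otimes> g = g \<otimes> x" "y \<otimes> g = g \<otimes> y"
        using x y g by (auto simp: group_center_def)
      have "x \<otimes> y \<otimes> g = x \<otimes> g \<otimes> y" using c(1,2) g by (simp add: m_assoc c(4))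
      then show ?thesis using c(1,2) g by (simp add: m_assoc c(3))
    qed
    then show "x \<otimes> y \<in> ?Z" using x y unfolding group_center_def by blast
  qed (use \<open>finite (carrier G)\<close> in \<open>auto simp: group_center_def\<close>)
  then have normal: "?Z \<lhd> G"
  proof (rule normalI_commuting)
    fix g x assume "g \<in> carrier G" "x \<in> ?Z"
    then show "\<exists>y\<in>?Z. g \<otimes> x = y \<otimes> g" by (intro bexI[of _ x]) (auto simp: group_center_def)
  qed
  interpret Z: normal ?Z G by fact
  interpret Q: group "G Mod ?Z" by (rule Z.factorgroup_is_group)
  have absorb: "?Z #> (z \<otimes> x) = ?Z #> x" if "z \<in> ?Z" "x \<in> carrier G" for z x
    using that Z.subset by (metis Z.is_subgroup Z.mem_carrier coset_join2 coset_mult_assoc)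
  have "comm_group (G Mod ?Z)"
  proof (rule Q.group_comm_groupI)
    fix C D assume "C \<in> carrier (G Mod ?Z)" "D \<in> carrier (G Mod ?Z)"
    then obtain x y where "x \<in> carrier G" "C = ?Z #> x" "y \<in> carrier G" "D = ?Z #> y"
      by (auto simp: carrier_FactGroup)
    then show "C \<otimes>\<^bsub>G Mod ?Z\<^esub> D = D \<otimes>\<^bsub>G Mod ?Z\<^esub> C"
      using comm[of x y] by (auto simp: Z.rcos_sum absorb)
  qed
  moreover have "C [^]\<^bsub>G Mod ?Z\<^esub> p = \<one>\<^bsub>G Mod ?Z\<^esub>" if C: "C \<in> carrier (G Mod ?Z)" for C
  proof -
    obtain x where "x \<in> carrier G" "C = ?Z #> x" using C by (auto simp: carrier_FactGroup)
    then show ?thesis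
      using coset_join2[OF one_closed Z.is_subgroup Z.one_closed] by (simp add: Z.FactGroup_pow pow)
  qed
  ultimately have "elementary_abelian p (G Mod ?Z)" by (simp add: elementary_abelian_def)
  moreover have "\<not> trivial_group (G Mod ?Z)"
  proof
    assume "trivial_group (G Mod ?Z)"
    then have "carrier G \<subseteq> ?Z"
      using rcos_self[OF _ Z.is_subgroup]
      by (auto simp: trivial_group_def carrier_FactGroup)
    then have "order G \<le> p"
      using center p1 unfolding order_def by (metis card.infinite card_mono not_one_less_zero)
    moreover have "p < p ^ 3" using p1 power_strict_increasing[of 1 3 p] by simp
    ultimately show False using order by simp
  qed
  ultimately have "extraspecial p G"
    using order center is_group unfolding extraspecial_def by blast
  moreover have "group_exponent G = p"
    unfolding group_exponent_def
  proof (rule Least_equality)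
    show "0 < p \<and> (\<forall>x\<in>carrier G. x [^] p = \<one>)" using p1 pow by auto
    fix n :: nat assume n: "0 < n \<and> (\<forall>x\<in>carrier G. x [^] n = \<one>)"
    have "carrier G \<noteq> {\<one>}" using order one_less_power[OF p1, of 3] by (auto simp: order_def)
    then obtain x where x: "x \<in> carrier G" "x \<noteq> \<one>" using one_closed by blast
    have "ord x dvd p" "ord x dvd n" using x n pow pow_eq_id by auto
    moreover have "ord x \<noteq> 1" using x ord_eq_1 by blast
    ultimately have "p dvd n" using p by (metis prime_nat_iff)
    then show "p \<le> n" using n by (auto intro: dvd_imp_le)
  qed
  ultimately show ?thesis using order by (simp add: extraspecial_plus_def)
qed

section \<open>Invariance under isomorphism\<close>

lemma iso_image_factor_group:
  assumes h: "h \<in> hom G H" and A: "A \<lhd> G" and onto: "h ` carrier G = carrier H"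
  shows "(\<lambda>C. h ` C) \<in> epi (G Mod A) (H Mod (h ` A))"
proof -
  interpret A: normal A G by fact
  have cl: "x \<in> carrier G \<Longrightarrow> h x \<in> carrier H" for x using h by (auto simp: hom_def)
  have mult: "x \<in> carrier G \<Longrightarrow> y \<in> carrier G \<Longrightarrow> h (x \<otimes>\<^bsub>G\<^esub> y) = h x \<otimes>\<^bsub>H\<^esub> h y" for x y
    using h by (auto simp: hom_def)
  have coset: "h ` (A #>\<^bsub>G\<^esub> x) = h ` A #>\<^bsub>H\<^esub> h x" if "x \<in> carrier G" for x
    using that A.mem_carrier by (force simp: r_coset_def mult)
  have set_mult: "h ` (C <#>\<^bsub>G\<^esub> D) = h ` C <#>\<^bsub>H\<^esub> h ` D"
    if "C \<subseteq> carrier G" "D \<subseteq> carrier G" for C D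
    using that by (force simp: set_mult_def mult subset_iff)
  have "C \<subseteq> carrier G" if "C \<in> carrier (G Mod A)" for C
    using that A.r_coset_subset_G A.subset by (auto simp: carrier_FactGroup)
  then have "(\<lambda>C. h ` C) \<in> hom (G Mod A) (H Mod (h ` A))"
    by (intro homI) (auto simp: set_mult, auto simp: carrier_FactGroup coset cl)
  moreover have "(\<lambda>C. h ` C) ` carrier (G Mod A) = carrier (H Mod (h ` A))"
    by (auto simp: carrier_FactGroup image_image coset simp flip: onto)
  ultimately show ?thesis by (simp add: epi_def)
qed

lemma supersoluble_iso:
  assumes ss: "supersoluble G" and H: "group H" and h: "h \<in> iso G H"
  shows "supersoluble H"
proof -
  have G: "group G" and finG: "finite (carrier G)" using ss by (auto simp: supersoluble_def)
  have hom: "h \<in> hom G H" and onto: "h ` carrier G = carrier H" and inj: "inj_on h (carrier G)"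
    using h by (auto simp: Group.iso_iff)
  interpret G: group G by fact
  interpret H: group H by fact
  interpret h: group_hom G H h by unfold_locales (rule hom)
  obtain K r where K: "K 0 = {\<one>\<^bsub>G\<^esub>}" "K r = carrier G" and norm: "\<And>i. i \<le> r \<Longrightarrow> K i \<lhd> G"
    and mono: "\<And>i. i < r \<Longrightarrow> K i \<subseteq> K (Suc i)"
    and cyc: "\<And>i. i < r \<Longrightarrow> cyclic_group ((G\<lparr>carrier := K (Suc i)\<rparr>) Mod K i)"
    using ss unfolding supersoluble_def by metis
  have norm': "h ` K i \<lhd> H" if "i \<le> r" for i
    using iso_normal_subgroup[OF h G H norm[OF that]] .
  have "cyclic_group ((H\<lparr>carrier := h ` K (Suc i)\<rparr>) Mod (h ` K i))" if i: "i < r" for i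
  proof -
    let ?B = "G\<lparr>carrier := K (Suc i)\<rparr>" and ?B' = "H\<lparr>carrier := h ` K (Suc i)\<rparr>"
    have i': "i \<le> r" "Suc i \<le> r" using i by auto
    have sub: "K (Suc i) \<subseteq> carrier G"
      using norm[OF i'(2)] normal_imp_subgroup subgroup.subset by blast
    have A: "K i \<lhd> ?B"
      using G.normal_restrict_supergroup[OF _ norm[OF i'(1)] mono[OF i]] norm[OF i'(2)]
      by (simp add: normal_imp_subgroup)
    have A': "h ` K i \<lhd> ?B'"
      using H.normal_restrict_supergroup[OF _ norm'[OF i'(1)]] norm'[OF i'(2)] mono[OF i]
      by (simp add: normal_imp_subgroup image_mono)
    have "h \<in> hom ?B ?B'"
      using sub by (intro homI) (auto simp: subset_iff)
    from iso_image_factor_group[OF this A]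
    have e: "(\<lambda>C. h ` C) \<in> epi (?B Mod K i) (?B' Mod (h ` K i))" by simp
    show ?thesis
      using group.cyclic_group_epimorphic_image[OF normal.factorgroup_is_group[OF A] e cyc[OF i]
          normal.factorgroup_is_group[OF A']] .
  qed
  then show ?thesis
    unfolding supersoluble_def
    using H finG onto norm' mono K
    by (intro conjI exI[of _ "\<lambda>i. h ` K i"] exI[of _ r])
       (auto simp: image_mono simp flip: onto)
qed

lemma generative_ingleton_violator_iso:
  assumes v: "generative_ingleton_violator G" and H: "group H" and h: "h \<in> iso G H"
  shows "generative_ingleton_violator H"
proof -
  have G: "group G" and finG: "finite (carrier G)"
    using v by (auto simp: generative_ingleton_violator_def)
  have hom: "h \<in> hom G H" and onto: "h ` carrier G = carrier H" and inj: "inj_on h (carrier G)"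
    using h by (auto simp: Group.iso_iff)
  interpret h: group_hom G H h using G H hom by (simp add: group_hom_def group_hom_axioms_def)
  obtain H1 H2 H3 H4 where off: "ingleton_offender G H1 H2 H3 H4"
    and gen: "generate G (H1 \<union> H2 \<union> H3 \<union> H4) = carrier G"
    using v unfolding generative_ingleton_violator_def generative_ingleton_offender_def by blast
  have sub: "subgroup H1 G" "subgroup H2 G" "subgroup H3 G" "subgroup H4 G"
    using off by (auto simp: ingleton_offender_def)
  then have c: "H1 \<subseteq> carrier G" "H2 \<subseteq> carrier G" "H3 \<subseteq> carrier G" "H4 \<subseteq> carrier G"
    by (auto dest: subgroup.subset)
  have int: "h ` (A \<inter> B) = h ` A \<inter> h ` B" if "A \<subseteq> carrier G" "B \<subseteq> carrier G" for A B
    using inj that by (rule inj_on_image_Int)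
  have card: "card (h ` A) = card A" if "A \<subseteq> carrier G" for A
    using inj that by (meson card_image inj_on_subset)
  have "ingleton_offender H (h ` H1) (h ` H2) (h ` H3) (h ` H4)"
    using off c unfolding ingleton_offender_def
    by (simp add: h.subgroup_img_is_subgroup card le_infI1 flip: int)
  moreover have "generate H (h ` H1 \<union> h ` H2 \<union> h ` H3 \<union> h ` H4) = carrier H"
    using h.generate_img[of "H1 \<union> H2 \<union> H3 \<union> H4"] c by (simp add: gen onto image_Un)
  ultimately show ?thesis
    using H finG unfolding generative_ingleton_violator_def generative_ingleton_offender_def onto[symmetric]
    by blast
qed

text \<open>A group over a countable type has an isomorphic copy whose elements are natural numbers, so
  groups of varying type can be gathered in one set.\<close>
lemma iso_nat_monoid:
  fixes G :: "('a::countable) monoid"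
  assumes "group G"
  obtains H :: "nat monoid" and h where "group H" "h \<in> iso G H"
proof -
  define H :: "nat monoid" where
    "H = \<lparr>carrier = to_nat ` carrier G,
          monoid.mult = (\<lambda>a b. to_nat (from_nat a \<otimes>\<^bsub>G\<^esub> from_nat b)), one = to_nat \<one>\<^bsub>G\<^esub>\<rparr>"
  have iso: "to_nat \<in> iso G H"
    by (auto simp: Group.iso_iff H_def hom_def intro: inj_on_subset[OF inj_to_nat])
  have "group H"
    using group.iso_imp_img_group[OF assms iso] by (simp add: H_def)
  then show thesis using iso that by blast
qed

section \<open>The group of the construction\<close>

text \<open>\<open>g\<close> is a generator of the multiplicative group modulo \<open>p\<close>; its powers are the scalars by which
  the cyclic factor acts. The bound \<open>5 \<le> p\<close> is what \<open>p\<^sup>2 < 2(p - 1)\<^sup>2\<close> needs.\<close>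
locale heisenberg_torus =
  fixes p g :: nat
  assumes prime: "Factorial_Ring.prime p" and p5: "5 \<le> p" and primroot: "residue_primroot p g"
begin

(* keeps p - 1 from being rewritten to p - Suc 0 *)
declare One_nat_def [simp del]

lemma p_pos: "0 < p" using p5 by simp

text \<open>The upper unitriangular matrix modulo \<open>p\<close> with entries \<open>x\<close>, \<open>y\<close> next to the diagonal and
  \<open>z\<close> in the corner, coded as a number. All integers are admitted as arguments, so that the group
  laws become polynomial identities over the integers and reduction modulo \<open>p\<close> only enters through
  equality.\<close>
definition heis :: "int \<Rightarrow> int \<Rightarrow> int \<Rightarrow> nat" where
  "heis x y z = to_nat (x mod int p, y mod int p, z mod int p)"

definition P :: "nat monoid" where
  "P = \<lparr>carrier = {heis x y z |x y z. True},
        monoid.mult = (\<lambda>a b. case from_nat a of (x, y, z) \<Rightarrow> case from_nat b of (x', y', z') \<Rightarrow>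
                   heis (x + x') (y + y') (z + z' + x * y')),
        one = heis 0 0 0\<rparr>"

text \<open>The generator of the cyclic group scales \<open>x\<close> and \<open>y\<close> by \<open>g\<close>, hence \<open>z\<close> by \<open>g\<^sup>2\<close>.\<close>
definition act :: "int \<Rightarrow> nat \<Rightarrow> nat" where
  "act k = (\<lambda>a\<in>carrier P. case from_nat a of (x, y, z) \<Rightarrow>
             heis (int g ^ nat k * x) (int g ^ nat k * y) ((int g ^ nat k)\<^sup>2 * z))"

abbreviation G where "G \<equiv> semidirect_product P (integer_mod_group (p - 1)) act"

text \<open>As with \<^const>\<open>heis\<close>, every natural number is a legitimate exponent \<open>k\<close>. Then the scalar
  attached to a product is exactly \<open>g ^ k * g ^ k'\<close>, with no reduction of \<open>k + k'\<close>.\<close>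
definition el :: "int \<Rightarrow> int \<Rightarrow> int \<Rightarrow> nat \<Rightarrow> nat \<times> int" where
  "el x y z k = (heis x y z, int (k mod (p - 1)))"

lemma heis_eq_iff:
  "heis x y z = heis x' y' z' \<longleftrightarrow> [x = x'] (mod int p) \<and> [y = y'] (mod int p) \<and> [z = z'] (mod int p)"
  by (auto simp: heis_def cong_def)

lemma carrier_P: "carrier P = {heis x y z |x y z. True}"
  and one_P [simp]: "\<one>\<^bsub>P\<^esub> = heis 0 0 0"
  by (simp_all add: P_def)

lemma P_cases: "a \<in> carrier P \<Longrightarrow> (\<And>x y z. a = heis x y z \<Longrightarrow> thesis) \<Longrightarrow> thesis"
  by (auto simp: carrier_P)

lemma heis_in_P [simp]: "heis x y z \<in> carrier P"
  by (auto simp: carrier_P)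

lemma heis_mult [simp]: "heis x y z \<otimes>\<^bsub>P\<^esub> heis x' y' z' = heis (x + x') (y + y') (z + z' + x * y')"
proof -
  have "from_nat (heis a b c) = (a mod int p, b mod int p, c mod int p)" for a b c
    by (simp add: heis_def)
  then show ?thesis
    by (auto simp: P_def heis_eq_iff intro!: cong_add cong_mult)
qed

lemma act_heis [simp]:
  "act k (heis x y z) = heis (int g ^ nat k * x) (int g ^ nat k * y) ((int g ^ nat k)\<^sup>2 * z)"
proof -
  have "from_nat (heis a b c) = (a mod int p, b mod int p, c mod int p)" for a b c
    by (simp add: heis_def)
  then show ?thesis
    by (auto simp: act_def heis_eq_iff intro!: cong_mult)
qed

lemma group_P: "group P"
proof (rule groupI)
  fix a assume "a \<in> carrier P"
  then obtain x y z where a: "a = heis x y z" by (auto simp: carrier_P)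
  show "\<exists>b\<in>carrier P. b \<otimes>\<^bsub>P\<^esub> a = \<one>\<^bsub>P\<^esub>"
    by (rule bexI[of _ "heis (- x) (- y) (x * y - z)"]) (simp_all add: a)
qed (auto elim!: P_cases simp: algebra_simps)

sublocale P: group P by (rule group_P)

lemma heis_pow: "heis x y z [^]\<^bsub>P\<^esub> n = heis (int n * x) (int n * y) (int n * z + int (n choose 2) * (x * y))"
  by (induction n) (simp_all add: algebra_simps numeral_2_eq_2)

lemma bij_betw_heis:
  "bij_betw (\<lambda>(x, y, z). heis x y z) ({0..<int p} \<times> {0..<int p} \<times> {0..<int p}) (carrier P)"
proof (rule bij_betw_imageI)
  show "inj_on (\<lambda>(x, y, z). heis x y z) ({0..<int p} \<times> {0..<int p} \<times> {0..<int p})"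
    by (auto simp: inj_on_def heis_eq_iff cong_def)
  have "heis x y z \<in> (\<lambda>(x, y, z). heis x y z) ` ({0..<int p} \<times> {0..<int p} \<times> {0..<int p})" for x y z
    using p_pos
    by (intro image_eqI[of _ _ "(x mod int p, y mod int p, z mod int p)"]) (auto simp: heis_eq_iff)
  then show "(\<lambda>(x, y, z). heis x y z) ` ({0..<int p} \<times> {0..<int p} \<times> {0..<int p}) = carrier P"
    by (auto elim!: P_cases)
qed

lemma finite_P: "finite (carrier P)"
  using bij_betw_finite[OF bij_betw_heis] by simp

lemma order_P: "order P = p ^ 3"
  using bij_betw_same_card[OF bij_betw_heis]
  by (simp add: order_def card_cartesian_product power3_eq_cube)

lemma center_P: "group_center P = {heis 0 0 z |z. True}"
proof (intro equalityI subsetI)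
  fix a assume a: "a \<in> group_center P"
  then obtain x y z where xyz: "a = heis x y z" by (auto simp: group_center_def carrier_P)
  have "a \<otimes>\<^bsub>P\<^esub> heis 1 0 0 = heis 1 0 0 \<otimes>\<^bsub>P\<^esub> a" "a \<otimes>\<^bsub>P\<^esub> heis 0 1 0 = heis 0 1 0 \<otimes>\<^bsub>P\<^esub> a"
    using a by (auto simp: group_center_def)
  then have "[x = 0] (mod int p)" "[y = 0] (mod int p)"
    by (auto simp: xyz heis_eq_iff cong_iff_dvd_diff)
  then have "a = heis 0 0 z" by (simp add: xyz heis_eq_iff)
  then show "a \<in> {heis 0 0 z |z. True}" by blast
qed (auto simp: group_center_def carrier_P algebra_simps)

lemma card_center_P: "card (group_center P) = p"
proof -
  have "bij_betw (heis 0 0) {0..<int p} (group_center P)"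
  proof (rule bij_betw_imageI)
    show "inj_on (heis 0 0) {0..<int p}" by (auto simp: inj_on_def heis_eq_iff cong_def)
    have "heis 0 0 z \<in> heis 0 0 ` {0..<int p}" for z
      using p_pos by (intro image_eqI[of _ _ "z mod int p"]) (auto simp: heis_eq_iff)
    then show "heis 0 0 ` {0..<int p} = group_center P"
      by (auto simp: center_P)
  qed
  then show ?thesis using bij_betw_same_card by fastforce
qed

lemma extraspecial_plus_P: "extraspecial_plus p P"
proof (rule P.extraspecial_plusI[OF prime order_P card_center_P])
  fix a b assume "a \<in> carrier P" "b \<in> carrier P"
  then obtain x y z x' y' z' where "a = heis x y z" "b = heis x' y' z'" by (auto simp: carrier_P)
  then have "a \<otimes>\<^bsub>P\<^esub> b = heis 0 0 (x * y' - x' * y) \<otimes>\<^bsub>P\<^esub> (b \<otimes>\<^bsub>P\<^esub> a)"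
    by (simp add: algebra_simps)
  then show "\<exists>c\<in>group_center P. a \<otimes>\<^bsub>P\<^esub> b = c \<otimes>\<^bsub>P\<^esub> (b \<otimes>\<^bsub>P\<^esub> a)"
    unfolding center_P by blast
next
  fix a assume "a \<in> carrier P"
  then obtain x y z where a: "a = heis x y z" by (auto simp: carrier_P)
  have "p dvd (p choose 2)" using prime p5 by (intro dvd_choose_prime) auto
  then have "int p dvd int (p choose 2)" by simp
  then show "a [^]\<^bsub>P\<^esub> p = \<one>\<^bsub>P\<^esub>"
    by (simp add: a heis_pow heis_eq_iff cong_0_iff)
qed

lemma g_pow_cong_iff: "[int g ^ k = int g ^ l] (mod int p) \<longleftrightarrow> [k = l] (mod p - 1)"
proof -
  have "coprime p g" "ord p g = p - 1"
    using primroot prime by (auto simp: residue_primroot_def totient_prime)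
  then have "[g ^ k = g ^ l] (mod p) \<longleftrightarrow> [k = l] (mod p - 1)"
    using order_divides_expdiff by metis
  then show ?thesis by (simp flip: cong_int_iff)
qed

lemma coprime_g_pow: "coprime (int g ^ k) (int p)"
  using primroot by (simp add: residue_primroot_def coprime_commute)

text \<open>\<open>g ^ k\<close> modulo \<open>p\<close> depends on \<open>k\<close> modulo \<open>p - 1\<close> only, so \<open>act\<close> respects the addition of the
  cyclic group; scaling by a unit is injective on a finite set, hence bijective.\<close>
lemma act_hom: "act \<in> hom (integer_mod_group (p - 1)) (AutoGroup P)"
proof (rule homI)
  have p1: "p - 1 \<noteq> 0" using p5 by simp
  have auto: "act k \<in> auto P" for k
  proof -
    have "act k \<in> hom P P"
      by (rule homI) (auto elim!: P_cases simp: algebra_simps power2_eq_square)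
    moreover have "inj_on (act k) (carrier P)"
    proof -
      have "coprime ((int g ^ nat k)\<^sup>2) (int p)"
        using coprime_g_pow[of "nat k * 2"] by (simp add: power_mult)
      then show ?thesis
        by (auto simp: inj_on_def carrier_P heis_eq_iff cong_mult_lcancel[OF coprime_g_pow]
            cong_mult_lcancel[of "(int g ^ nat k)\<^sup>2"] simp del: coprime_power_left_iff)
    qed
    moreover have "act k ` carrier P \<subseteq> carrier P" by (auto elim!: P_cases)
    ultimately show ?thesis
      using endo_inj_surj[OF finite_P]
      by (auto simp: auto_def Bij_def bij_betw_def act_def)
  qed
  then show "act k \<in> carrier (AutoGroup P)" for k by (simp add: AutoGroup_def)
  fix k l assume "k \<in> carrier (integer_mod_group (p - 1))" "l \<in> carrier (integer_mod_group (p - 1))"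
  then have kl: "0 \<le> k" "0 \<le> l" using p1 by (auto simp: carrier_integer_mod_group)
  have "nat ((k + l) mod int (p - 1)) = (nat k + nat l) mod (p - 1)"
    using kl by (simp add: nat_mod_distrib nat_add_distrib)
  then have e: "[int g ^ nat ((k + l) mod int (p - 1)) = int g ^ nat k * int g ^ nat l] (mod int p)"
    by (simp add: g_pow_cong_iff flip: power_add)
  have "act ((k + l) mod int (p - 1)) a = compose (carrier P) (act k) (act l) a" for a
  proof (cases "a \<in> carrier P")
    case True
    then obtain x y z where "a = heis x y z" by (auto simp: carrier_P)
    then show ?thesis
      using cong_mult[OF e cong_refl] cong_mult[OF cong_pow[OF e] cong_refl, of 2]
      by (simp add: compose_def heis_eq_iff mult.assoc power_mult_distrib)
  qed (simp add: act_def compose_def)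
  then show "act (k \<otimes>\<^bsub>integer_mod_group (p - 1)\<^esub> l) = act k \<otimes>\<^bsub>AutoGroup P\<^esub> act l"
    using auto by (auto simp: AutoGroup_def BijGroup_def auto_def)
qed

sublocale G: group G
  by (rule group_semidirect_product[OF group_P group_integer_mod_group act_hom])

lemma el_in_G [simp]: "el x y z k \<in> carrier G"
  using p5 mod_less_divisor[of "p - 1" k]
  by (simp add: el_def semidirect_product_def carrier_integer_mod_group del: mod_less_divisor)

lemma carrier_G: "carrier G = {el x y z k |x y z k. True}"
proof (intro equalityI subsetI)
  fix a assume "a \<in> carrier G"
  then obtain x y z k where "a = (heis x y z, k)" "0 \<le> k" "k < int (p - 1)"
    using p5 by (auto simp: semidirect_product_def carrier_integer_mod_group carrier_P split: if_splits)
  then have "a = el x y z (nat k)" by (simp add: el_def)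
  then show "a \<in> {el x y z k |x y z k. True}" by blast
qed auto

lemma finite_G: "finite (carrier G)"
  using p5 by (simp add: semidirect_product_def finite_P carrier_integer_mod_group)

lemma order_G: "order G = p ^ 3 * (p - 1)"
  using order_P p5
  by (simp add: order_def semidirect_product_def card_cartesian_product carrier_integer_mod_group)

lemma one_G [simp]: "\<one>\<^bsub>G\<^esub> = el 0 0 0 0"
  by (simp add: semidirect_product_def el_def)

lemma el_eq_iff:
  "el x y z k = el x' y' z' k' \<longleftrightarrow> [x = x'] (mod int p) \<and> [y = y'] (mod int p) \<and>
     [z = z'] (mod int p) \<and> [k = k'] (mod p - 1)"
  by (auto simp: el_def heis_eq_iff cong_def)

lemma el_mult [simp]:
  "el x y z k \<otimes>\<^bsub>G\<^esub> el x' y' z' k' =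
     el (x + int g ^ k * x') (y + int g ^ k * y')
        (z + (int g ^ k)\<^sup>2 * z' + x * (int g ^ k * y')) (k + k')"
proof -
  have e: "[int g ^ (k mod (p - 1)) = int g ^ k] (mod int p)"
    by (simp add: g_pow_cong_iff)
  have "int (k mod (p - 1)) + int (k' mod (p - 1)) = int (k mod (p - 1) + k' mod (p - 1))"
    by simp
  then have "(int (k mod (p - 1)) + int (k' mod (p - 1))) mod int (p - 1) = int ((k + k') mod (p - 1))"
    by (simp only: zmod_int[symmetric] mod_add_eq)
  then show ?thesis
    unfolding el_def
    by (simp add: semidirect_product_def heis_eq_iff del: of_nat_mod)
       (intro conjI cong_add cong_mult cong_pow e cong_refl)
qed

section \<open>The Ingleton offender\<close>

text \<open>The group acts on the points of \<open>P\<close>, an element \<open>(n, k)\<close> sending \<open>v\<close> to \<open>n\<close> times the \<open>k\<close>-scaled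
  \<open>v\<close>. Each \<open>H i\<close> is the stabiliser of one side of a closed quadrilateral in \<open>P\<close> with vertices
  \<open>(0,0,0)\<close>, \<open>(1,0,0)\<close>, \<open>(1,1,1)\<close>, \<open>(0,-1,0)\<close>: the side of \<open>H1\<close> joins the first two vertices, that of
  \<open>H4\<close> the second and third, that of \<open>H2\<close> the third and fourth, and that of \<open>H3\<close> the fourth and first.
  These sides are the left cosets \<open>(a,0,0)\<close>, \<open>(1,b,b)\<close>, \<open>(s,2s-1,s\<^sup>2)\<close> and \<open>(0,b,0)\<close> of subgroups of
  order \<open>p\<close> invariant under the scaling. Their order is \<open>1, 4, 2, 3\<close> around the quadrilateral, so
  that \<open>H1, H2\<close> and \<open>H3, H4\<close> are the pairs of opposite sides.\<close>
definition H1 where "H1 = {el a 0 0 k |a k. True}"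
definition H2 where "H2 = {el s (2 * s - 1 + int g ^ k) (s\<^sup>2 + s * int g ^ k) k |s k. True}"
definition H3 where "H3 = {el 0 b 0 k |b k. True}"
definition H4 where "H4 = {el (1 - int g ^ k) b b k |b k. True}"

lemma subgroup_H1: "subgroup H1 G"
proof (rule G.finite_closed_imp_subgroup[OF finite_G])
  show "H1 \<subseteq> carrier G" by (auto simp: H1_def)
  show "\<one>\<^bsub>G\<^esub> \<in> H1" by (auto simp: H1_def)
  fix x y assume "x \<in> H1" "y \<in> H1"
  then show "x \<otimes>\<^bsub>G\<^esub> y \<in> H1" by (auto simp: H1_def) blast
qed

lemma subgroup_H3: "subgroup H3 G"
proof (rule G.finite_closed_imp_subgroup[OF finite_G])
  show "H3 \<subseteq> carrier G" by (auto simp: H3_def)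
  show "\<one>\<^bsub>G\<^esub> \<in> H3" by (auto simp: H3_def)
  fix x y assume "x \<in> H3" "y \<in> H3"
  then show "x \<otimes>\<^bsub>G\<^esub> y \<in> H3" by (auto simp: H3_def) blast
qed

lemma subgroup_H2: "subgroup H2 G"
proof (rule G.finite_closed_imp_subgroup[OF finite_G])
  show "H2 \<subseteq> carrier G" by (auto simp: H2_def)
  have "el 0 (2 * 0 - 1 + int g ^ 0) (0\<^sup>2 + 0 * int g ^ 0) 0 \<in> H2" unfolding H2_def by blast
  then show "\<one>\<^bsub>G\<^esub> \<in> H2" by simp
  fix x y assume "x \<in> H2" "y \<in> H2"
  then obtain s k t l where xy:
    "x = el s (2 * s - 1 + int g ^ k) (s\<^sup>2 + s * int g ^ k) k"
    "y = el t (2 * t - 1 + int g ^ l) (t\<^sup>2 + t * int g ^ l) l"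
    by (auto simp: H2_def)
  define u where "u = s + int g ^ k * t"
  have "x \<otimes>\<^bsub>G\<^esub> y = el u (2 * u - 1 + int g ^ (k + l)) (u\<^sup>2 + u * int g ^ (k + l)) (k + l)"
    by (simp add: xy u_def algebra_simps power2_eq_square power_add)
  then show "x \<otimes>\<^bsub>G\<^esub> y \<in> H2" unfolding H2_def by blast
qed

lemma subgroup_H4: "subgroup H4 G"
proof (rule G.finite_closed_imp_subgroup[OF finite_G])
  show "H4 \<subseteq> carrier G" by (auto simp: H4_def)
  have "el (1 - int g ^ 0) 0 0 0 \<in> H4" unfolding H4_def by blast
  then show "\<one>\<^bsub>G\<^esub> \<in> H4" by simp
  fix x y assume "x \<in> H4" "y \<in> H4"
  then obtain b k c l where xy: "x = el (1 - int g ^ k) b b k" "y = el (1 - int g ^ l) c c l"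
    by (auto simp: H4_def)
  define d where "d = b + int g ^ k * c"
  have "x \<otimes>\<^bsub>G\<^esub> y = el (1 - int g ^ (k + l)) d d (k + l)"
    by (simp add: xy d_def algebra_simps power2_eq_square power_add)
  then show "x \<otimes>\<^bsub>G\<^esub> y \<in> H4" unfolding H4_def by blast
qed

lemma card_H1: "card H1 \<le> p * (p - 1)"
proof -
  have "H1 \<subseteq> (\<lambda>(a, k). el a 0 0 k) ` ({0..<int p} \<times> {..<p - 1})"
  proof
    fix x assume "x \<in> H1"
    then obtain a k where "x = el a 0 0 k" by (auto simp: H1_def)
    then show "x \<in> (\<lambda>(a, k). el a 0 0 k) ` ({0..<int p} \<times> {..<p - 1})"
      using p5 by (intro image_eqI[of _ _ "(a mod int p, k mod (p - 1))"]) (auto simp: el_eq_iff)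
  qed
  from surj_card_le[OF _ this] show ?thesis by (simp add: card_cartesian_product)
qed

lemma card_H2: "card H2 \<le> p * (p - 1)"
proof -
  let ?f = "\<lambda>(s, k). el s (2 * s - 1 + int g ^ k) (s\<^sup>2 + s * int g ^ k) k"
  have "H2 \<subseteq> ?f ` ({0..<int p} \<times> {..<p - 1})"
  proof
    fix x assume "x \<in> H2"
    then obtain s k where x: "x = ?f (s, k)" by (auto simp: H2_def)
    have "[s = s mod int p] (mod int p)" "[int g ^ k = int g ^ (k mod (p - 1))] (mod int p)"
      by (simp_all add: g_pow_cong_iff)
    then have "x = ?f (s mod int p, k mod (p - 1))"
      unfolding x prod.case el_eq_iff
      by (intro conjI cong_add cong_diff cong_mult cong_pow cong_refl) (auto simp: g_pow_cong_iff)
    then show "x \<in> ?f ` ({0..<int p} \<times> {..<p - 1})"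
      using p5 by (intro image_eqI[of _ _ "(s mod int p, k mod (p - 1))"]) auto
  qed
  from surj_card_le[OF _ this] show ?thesis by (simp add: card_cartesian_product)
qed

lemma el_in_H1: "el x y z k \<in> H1 \<longleftrightarrow> [y = 0] (mod int p) \<and> [z = 0] (mod int p)"
proof
  assume "[y = 0] (mod int p) \<and> [z = 0] (mod int p)"
  then have "el x y z k = el x 0 0 k" by (simp add: el_eq_iff)
  then show "el x y z k \<in> H1" by (auto simp: H1_def)
qed (auto simp: H1_def el_eq_iff)

lemma el_in_H3: "el x y z k \<in> H3 \<longleftrightarrow> [x = 0] (mod int p) \<and> [z = 0] (mod int p)"
proof
  assume "[x = 0] (mod int p) \<and> [z = 0] (mod int p)"
  then have "el x y z k = el 0 y 0 k" by (simp add: el_eq_iff)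
  then show "el x y z k \<in> H3" by (auto simp: H3_def)
qed (auto simp: H3_def el_eq_iff)

lemma el_in_H4: "el x y z k \<in> H4 \<longleftrightarrow> [x = 1 - int g ^ k] (mod int p) \<and> [y = z] (mod int p)"
proof
  assume "[x = 1 - int g ^ k] (mod int p) \<and> [y = z] (mod int p)"
  then have "el x y z k = el (1 - int g ^ k) z z k" by (simp add: el_eq_iff)
  then show "el x y z k \<in> H4" by (auto simp: H4_def)
next
  assume "el x y z k \<in> H4"
  then obtain b l where b: "[x = 1 - int g ^ l] (mod int p)" "[y = b] (mod int p)" "[z = b] (mod int p)"
    and "[k = l] (mod p - 1)"
    by (auto simp: H4_def el_eq_iff)
  then have "[1 - int g ^ l = 1 - int g ^ k] (mod int p)"
    by (intro cong_diff cong_refl) (simp add: g_pow_cong_iff cong_sym)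
  then show "[x = 1 - int g ^ k] (mod int p) \<and> [y = z] (mod int p)"
    using b cong_trans cong_sym by blast
qed

lemma el_in_H2: "el x y z k \<in> H2 \<longleftrightarrow>
    [y = 2 * x - 1 + int g ^ k] (mod int p) \<and> [z = x\<^sup>2 + x * int g ^ k] (mod int p)"
proof
  assume "[y = 2 * x - 1 + int g ^ k] (mod int p) \<and> [z = x\<^sup>2 + x * int g ^ k] (mod int p)"
  then have "el x y z k = el x (2 * x - 1 + int g ^ k) (x\<^sup>2 + x * int g ^ k) k"
    by (simp add: el_eq_iff)
  then show "el x y z k \<in> H2" unfolding H2_def by blast
next
  assume "el x y z k \<in> H2"
  then obtain s l where s: "[s = x] (mod int p)" "[y = 2 * s - 1 + int g ^ l] (mod int p)"
      "[z = s\<^sup>2 + s * int g ^ l] (mod int p)" and "[k = l] (mod p - 1)"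
    by (auto simp: H2_def el_eq_iff cong_sym_eq)
  then have "[int g ^ l = int g ^ k] (mod int p)" by (simp add: g_pow_cong_iff cong_sym)
  then have "[2 * s - 1 + int g ^ l = 2 * x - 1 + int g ^ k] (mod int p)"
    "[s\<^sup>2 + s * int g ^ l = x\<^sup>2 + x * int g ^ k] (mod int p)"
    using s(1) by (auto intro!: cong_add cong_diff cong_mult cong_pow)
  then show "[y = 2 * x - 1 + int g ^ k] (mod int p) \<and> [z = x\<^sup>2 + x * int g ^ k] (mod int p)"
    using s(2,3) cong_trans by blast
qed

lemmas el_in_H = el_in_H1 el_in_H2 el_in_H3 el_in_H4

lemma el_eq_oneI:
  assumes "int p dvd x" "int p dvd y" "int p dvd z" "int p dvd int g ^ k - 1"
  shows "el x y z k = \<one>\<^bsub>G\<^esub>"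
proof -
  have "[int g ^ k = int g ^ 0] (mod int p)" using assms(4) by (simp add: cong_iff_dvd_diff)
  then show ?thesis using assms(1-3) unfolding g_pow_cong_iff by (simp add: el_eq_iff cong_0_iff)
qed

lemma H_sub: "H1 \<subseteq> carrier G" "H2 \<subseteq> carrier G" "H3 \<subseteq> carrier G" "H4 \<subseteq> carrier G"
  using subgroup_H1 subgroup_H2 subgroup_H3 subgroup_H4 by (auto dest: subgroup.subset)

lemma H_cases:
  assumes "a \<in> H1 \<or> a \<in> H3"
  obtains x y z k where "a = el x y z k"
  using assms H_sub unfolding carrier_G by blast

text \<open>Modulo the centre the sides of \<open>H3\<close> and \<open>H4\<close> are parallel: a common element would have to fix
  both \<open>x = 0\<close> and \<open>x = 1\<close>, so its scalar is \<open>1\<close>. As \<open>P\<close> is not abelian, a nontrivial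
  translation along the first side does not preserve the second.\<close>
lemma H34_trivial: "H3 \<inter> H4 \<subseteq> {\<one>\<^bsub>G\<^esub>}"
proof
  fix a assume a: "a \<in> H3 \<inter> H4"
  then obtain x y z k where axyz: "a = el x y z k" using H_cases by blast
  from a have xyz: "int p dvd x" "int p dvd z" "int p dvd x - (1 - int g ^ k)" "int p dvd y - z"
    by (auto simp: axyz el_in_H cong_iff_dvd_diff)
  have "y = (y - z) + z" "int g ^ k - 1 = (x - (1 - int g ^ k)) - x" by simp_all
  then have "int p dvd y" "int p dvd int g ^ k - 1" using xyz by (metis dvd_add, metis dvd_diff)
  then show "a \<in> {\<one>\<^bsub>G\<^esub>}" using xyz el_eq_oneI unfolding axyz by blast
qed

text \<open>An element of \<open>H1 \<inter> H3\<close> fixes the vertex \<open>(0,0,0)\<close>, so it is a pure scaling. It moves the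
  vertex \<open>(0,-1,0)\<close> of the side of \<open>H2\<close> along the side of \<open>H3\<close>, and these two sides share no other
  point.\<close>
lemma H123_trivial: "H1 \<inter> H2 \<inter> H3 \<subseteq> {\<one>\<^bsub>G\<^esub>}"
proof
  fix a assume a: "a \<in> H1 \<inter> H2 \<inter> H3"
  then obtain x y z k where axyz: "a = el x y z k" using H_cases by blast
  from a have xyz: "int p dvd x" "int p dvd y" "int p dvd z" "int p dvd y - (2 * x - 1 + int g ^ k)"
    by (auto simp: axyz el_in_H cong_iff_dvd_diff)
  have "int g ^ k - 1 = y - (y - (2 * x - 1 + int g ^ k)) - 2 * x" by simp
  then have "int p dvd int g ^ k - 1" using xyz by (metis dvd_diff dvd_mult)
  then show "a \<in> {\<one>\<^bsub>G\<^esub>}"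
    using xyz el_eq_oneI unfolding axyz by blast
qed

text \<open>The same argument at the vertex \<open>(1,0,0)\<close>, with \<open>(1,1,1)\<close> in place of \<open>(0,-1,0)\<close>.\<close>
lemma H124_trivial: "H1 \<inter> H2 \<inter> H4 \<subseteq> {\<one>\<^bsub>G\<^esub>}"
proof
  fix a assume a: "a \<in> H1 \<inter> H2 \<inter> H4"
  then obtain x y z k where axyz: "a = el x y z k" using H_cases by blast
  from a have xyz: "int p dvd x - (1 - int g ^ k)" "int p dvd y" "int p dvd z"
      "int p dvd y - (2 * x - 1 + int g ^ k)"
    by (auto simp: axyz el_in_H cong_iff_dvd_diff)
  have "int g ^ k - 1 = 2 * (x - (1 - int g ^ k)) + (y - (2 * x - 1 + int g ^ k)) - y" by simp
  then have g: "int p dvd int g ^ k - 1" using xyz by (metis dvd_add dvd_diff dvd_mult)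
  have "x = (x - (1 - int g ^ k)) - (int g ^ k - 1)" by simp
  then have "int p dvd x" using xyz(1) g by (metis dvd_diff)
  then show "a \<in> {\<one>\<^bsub>G\<^esub>}" using xyz g el_eq_oneI unfolding axyz by blast
qed

lemma card_trivial: "S \<subseteq> {\<one>\<^bsub>G\<^esub>} \<Longrightarrow> card S \<le> 1"
  using card_mono[of "{\<one>\<^bsub>G\<^esub>}" S] by simp

text \<open>Adjacent sides meet in a vertex, whose stabiliser is a conjugate of the cyclic factor and thus
  contains one element for each exponent \<open>k\<close>.\<close>
lemma card_ge:
  assumes S: "S \<subseteq> carrier G" and f: "\<And>k. el (f k) (h k) (i k) k \<in> S"
  shows "p - 1 \<le> card S"
proof -
  have "inj_on (\<lambda>k. el (f k) (h k) (i k) k) {..<p - 1}"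
    by (auto simp: inj_on_def el_eq_iff cong_def)
  then have "card ((\<lambda>k. el (f k) (h k) (i k) k) ` {..<p - 1}) = p - 1"
    by (simp add: card_image)
  moreover have "(\<lambda>k. el (f k) (h k) (i k) k) ` {..<p - 1} \<subseteq> S" using f by blast
  ultimately show ?thesis using card_mono[OF finite_subset[OF S finite_G]] by metis
qed

lemma card_H13: "p - 1 \<le> card (H1 \<inter> H3)"
  by (rule card_ge[of _ "\<lambda>k. 0" "\<lambda>k. 0" "\<lambda>k. 0"]) (use H_sub in \<open>auto simp: el_in_H\<close>)

lemma card_H14: "p - 1 \<le> card (H1 \<inter> H4)"
  by (rule card_ge[of _ "\<lambda>k. 1 - int g ^ k" "\<lambda>k. 0" "\<lambda>k. 0"]) (use H_sub in \<open>auto simp: el_in_H\<close>)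

lemma card_H23: "p - 1 \<le> card (H2 \<inter> H3)"
  by (rule card_ge[of _ "\<lambda>k. 0" "\<lambda>k. int g ^ k - 1" "\<lambda>k. 0"])
     (use H_sub in \<open>auto simp: el_in_H\<close>)

lemma card_H24: "p - 1 \<le> card (H2 \<inter> H4)"
  by (rule card_ge[of _ "\<lambda>k. 1 - int g ^ k" "\<lambda>k. 1 - int g ^ k" "\<lambda>k. 1 - int g ^ k"])
     (use H_sub in \<open>auto simp: el_in_H algebra_simps power2_eq_square\<close>)

text \<open>Modulo the centre the sides of \<open>H1\<close> and \<open>H2\<close> intersect in the point \<open>x = 1/2\<close>, \<open>y = 0\<close>. The
  scalar \<open>-1\<close> acts trivially on the centre, so the involution at this point preserves both sides.\<close>
lemma card_H12: "2 \<le> card (H1 \<inter> H2)"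
proof -
  \<comment> \<open>the exponent with \<open>g ^ m = -1\<close>\<close>
  define m where "m = (p - 1) div 2"
  have "odd p" using prime p5 by (intro prime_odd_nat) auto
  then have m: "p - 1 = 2 * m" using p5 by (auto simp: m_def elim!: oddE)
  have "[int g ^ (m * 2) = int g ^ 0] (mod int p)"
    unfolding g_pow_cong_iff m by (simp add: cong_def)
  then have "int p dvd (int g ^ m)\<^sup>2 - 1" by (simp add: cong_iff_dvd_diff power_mult)
  then have "int p dvd (int g ^ m - 1) * (int g ^ m + 1)"
    by (simp add: algebra_simps power2_eq_square)
  then have "int p dvd int g ^ m - 1 \<or> int p dvd int g ^ m + 1"
    using prime by (simp add: prime_dvd_mult_iff)
  moreover have "\<not> int p dvd int g ^ m - 1"
  proof
    assume "int p dvd int g ^ m - 1"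
    then have "[m = 0] (mod p - 1)" using g_pow_cong_iff[of m 0] by (simp add: cong_iff_dvd_diff)
    then show False using m p5 by (simp add: cong_def)
  qed
  ultimately have "int p dvd int g ^ m + 1" by blast
  then have "[0 = int g ^ m + 1] (mod int p)" by (simp add: cong_sym_eq[of 0] cong_0_iff)
  then have "el 1 0 0 m \<in> H1 \<inter> H2" by (simp add: el_in_H add.commute)
  moreover have "el 0 0 0 0 \<in> H1 \<inter> H2" by (simp add: el_in_H)
  moreover have "el 1 0 0 m \<noteq> el 0 0 0 0" using p5 by (simp add: el_eq_iff cong_def)
  moreover have "finite (H1 \<inter> H2)" using H_sub finite_G finite_subset by blast
  ultimately show ?thesis
    using card_mono[of "H1 \<inter> H2" "{el 1 0 0 m, el 0 0 0 0}"] by simp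
qed

lemma offender: "ingleton_offender G H1 H2 H3 H4"
proof -
  define n where "n = p - 1"
  have "4 \<le> n" and p: "p = n + 1" using p5 by (auto simp: n_def)
  have "p\<^sup>2 < 2 * n\<^sup>2"
    using mult_le_mono1[OF \<open>4 \<le> n\<close>, of n] \<open>4 \<le> n\<close>
    unfolding p power2_eq_square distrib_left distrib_right by linarith
  have "card H1 * card H2 * card (H3 \<inter> H4) * card (H1 \<inter> H2 \<inter> H3) * card (H1 \<inter> H2 \<inter> H4)
      \<le> (p * n) * (p * n) * 1 * 1 * 1"
    unfolding n_def
    by (intro mult_le_mono card_H1 card_H2 card_trivial H34_trivial H123_trivial H124_trivial)
  also have "\<dots> = p\<^sup>2 * n\<^sup>2" by (simp add: power2_eq_square)
  also have "\<dots> < 2 * n\<^sup>2 * n\<^sup>2" using \<open>p\<^sup>2 < 2 * n\<^sup>2\<close> \<open>4 \<le> n\<close> by simp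
  also have "\<dots> = 2 * n * n * n * n" by (simp add: power2_eq_square)
  also have "\<dots> \<le> card (H1 \<inter> H2) * card (H1 \<inter> H3) * card (H1 \<inter> H4) * card (H2 \<inter> H3) * card (H2 \<inter> H4)"
    unfolding n_def by (intro mult_le_mono card_H12 card_H13 card_H14 card_H23 card_H24)
  finally show ?thesis
    unfolding ingleton_offender_def using subgroup_H1 subgroup_H2 subgroup_H3 subgroup_H4 by simp
qed

lemma generate_H: "generate G (H1 \<union> H2 \<union> H3 \<union> H4) = carrier G"
proof
  let ?S = "generate G (H1 \<union> H2 \<union> H3 \<union> H4)"
  have "H1 \<union> H2 \<union> H3 \<union> H4 \<subseteq> carrier G" using H_sub by blast
  then show "?S \<subseteq> carrier G" using G.generate_in_carrier by blast
  have mult: "a \<otimes>\<^bsub>G\<^esub> b \<in> ?S" if "a \<in> ?S" "b \<in> ?S" for a b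
    using that by (rule generate.eng)
  have gen_x: "el a 0 0 k \<in> ?S" for a k by (rule generate.incl) (simp add: el_in_H)
  have gen_y: "el 0 b 0 k \<in> ?S" for b k by (rule generate.incl) (simp add: el_in_H)
  \<comment> \<open>the commutator of \<open>(1,0,0)\<close> and \<open>(0,z,0)\<close> is \<open>(0,0,z)\<close>\<close>
  have gen_z: "el 0 0 z 0 \<in> ?S" for z
    using mult[OF mult[OF gen_x[of 1 0] gen_y[of z 0]] mult[OF gen_x[of "- 1" 0] gen_y[of "- z" 0]]] by simp
  have "el x y z k \<in> ?S" for x y z k
    using mult[OF gen_z[of z] mult[OF gen_y[of y 0] gen_x[of x k]]] by simp
  then show "carrier G \<subseteq> ?S" by (auto simp: carrier_G)
qed

lemma violator: "generative_ingleton_violator G"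
  using offender generate_H finite_G G.is_group
  unfolding generative_ingleton_violator_def generative_ingleton_offender_def by blast

section \<open>Supersolubility\<close>

text \<open>The chain \<open>1 < Z < \<langle>X, Z\<rangle> < P < G\<close>: the four conditions free the coordinates \<open>z\<close>, \<open>x\<close>, \<open>y\<close> and \<open>k\<close>
  one after the other.\<close>
definition K :: "nat \<Rightarrow> (nat \<times> int) set" where
  "K i = {el x y z k |x y z k. (i < 1 \<longrightarrow> z = 0) \<and> (i < 2 \<longrightarrow> x = 0) \<and> (i < 3 \<longrightarrow> y = 0) \<and> (i < 4 \<longrightarrow> k = 0)}"

lemma el_in_K:
  "i < 1 \<longrightarrow> z = 0 \<Longrightarrow> i < 2 \<longrightarrow> x = 0 \<Longrightarrow> i < 3 \<longrightarrow> y = 0 \<Longrightarrow> i < 4 \<longrightarrow> k = 0 \<Longrightarrow> el x y z k \<in> K i"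
  unfolding K_def by blast

lemma K_cases:
  assumes "a \<in> K i"
  obtains x y z k where "a = el x y z k"
    "i < 1 \<longrightarrow> z = 0" "i < 2 \<longrightarrow> x = 0" "i < 3 \<longrightarrow> y = 0" "i < 4 \<longrightarrow> k = 0"
  using assms unfolding K_def by blast

lemma K_4: "K 4 = carrier G" by (auto simp: K_def carrier_G)

lemma K_mono: "i \<le> j \<Longrightarrow> K i \<subseteq> K j"
  by (auto elim!: K_cases intro!: el_in_K)

lemma subgroup_K: "subgroup (K i) G"
proof (rule G.finite_closed_imp_subgroup[OF finite_G])
  show "K i \<subseteq> carrier G" by (auto elim: K_cases)
  show "\<one>\<^bsub>G\<^esub> \<in> K i" by (simp add: el_in_K)
  fix a b assume "a \<in> K i" "b \<in> K i"
  from \<open>a \<in> K i\<close> obtain x y z k where a: "a = el x y z k"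
    and "i < 1 \<longrightarrow> z = 0" "i < 2 \<longrightarrow> x = 0" "i < 3 \<longrightarrow> y = 0" "i < 4 \<longrightarrow> k = 0"
    by (rule K_cases)
  moreover from \<open>b \<in> K i\<close> obtain x' y' z' k' where b: "b = el x' y' z' k'"
    and "i < 1 \<longrightarrow> z' = 0" "i < 2 \<longrightarrow> x' = 0" "i < 3 \<longrightarrow> y' = 0" "i < 4 \<longrightarrow> k' = 0"
    by (rule K_cases)
  ultimately show "a \<otimes>\<^bsub>G\<^esub> b \<in> K i"
    unfolding a b el_mult by (intro el_in_K) simp_all
qed

lemma normal_K: "i \<le> 4 \<Longrightarrow> K i \<lhd> G"
proof (cases "i = 4")
  case True
  then show ?thesis
    using G.normalI_commuting[OF subgroup_K] G.normal_inv_iff G.subgroup_self by (simp add: K_4)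
next
  case False
  moreover assume "i \<le> 4"
  ultimately have i: "i < 4" by simp
  show ?thesis
  proof (rule G.normalI_commuting[OF subgroup_K])
    fix h a assume "h \<in> carrier G" "a \<in> K i"
    then obtain A B C k where h: "h = el A B C k" by (auto simp: carrier_G)
    from \<open>a \<in> K i\<close> obtain x y z where a: "a = el x y z 0"
      and c: "i < 1 \<longrightarrow> z = 0" "i < 2 \<longrightarrow> x = 0" "i < 3 \<longrightarrow> y = 0"
      using i by (elim K_cases) auto
    define r where "r = int g ^ k"
    \<comment> \<open>the conjugate of \<open>a\<close> by \<open>h\<close>\<close>
    define b where "b = el (r * x) (r * y) (r\<^sup>2 * z + A * (r * y) - r * x * B) 0"
    have "b \<in> K i" unfolding b_def by (rule el_in_K) (auto simp: c)
    moreover have "h \<otimes>\<^bsub>G\<^esub> a = b \<otimes>\<^bsub>G\<^esub> h"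
      by (simp add: h a b_def r_def[symmetric] algebra_simps)
    ultimately show "\<exists>b\<in>K i. h \<otimes>\<^bsub>G\<^esub> a = b \<otimes>\<^bsub>G\<^esub> h" by blast
  qed
qed

lemma el_pow: "el x y z 0 [^]\<^bsub>G\<^esub> n = el (int n * x) (int n * y) (int n * z + int (n choose 2) * (x * y)) 0"
  by (induction n) (simp_all add: algebra_simps numeral_2_eq_2)

lemma torus_pow: "el 0 0 0 k [^]\<^bsub>G\<^esub> n = el 0 0 0 (n * k)"
  by (induction n) (simp_all add: algebra_simps)

lemma supersoluble_G: "supersoluble G"
proof (rule G.supersolubleI[where K = K and r = 4])
  show "finite (carrier G)" "K 4 = carrier G" by (fact finite_G K_4)+
  show "K i \<lhd> G" if "i \<le> 4" for i using that by (rule normal_K)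
  show "K 0 = {\<one>\<^bsub>G\<^esub>}" by (auto simp: K_def)
  show "K i \<subseteq> K (Suc i)" for i by (rule K_mono) simp
  fix i :: nat assume "i < 4"
  have nat_rep: "\<exists>n. [x = int n] (mod int p)" for x
    using p_pos by (intro exI[of _ "nat (x mod int p)"]) simp
  consider "i = 0" | "i = 1" | "i = 2" | "i = 3" using \<open>i < 4\<close> by linarith
  then show "\<exists>x\<in>K (Suc i). \<forall>b\<in>K (Suc i). \<exists>a\<in>K i. \<exists>n::nat. b = a \<otimes>\<^bsub>G\<^esub> x [^]\<^bsub>G\<^esub> n"
  proof cases
    case 1
    show ?thesis
    proof (rule bexI[of _ "el 0 0 1 0"], rule ballI)
      fix b assume "b \<in> K (Suc i)"
      then obtain z where "b = el 0 0 z 0" using 1 by (auto elim!: K_cases)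
      moreover obtain n where "[z = int n] (mod int p)" using nat_rep by blast
      ultimately have "b = el 0 0 0 0 \<otimes>\<^bsub>G\<^esub> el 0 0 1 0 [^]\<^bsub>G\<^esub> n"
        by (simp add: el_pow el_eq_iff)
      moreover have "el 0 0 0 0 \<in> K i" by (simp add: el_in_K)
      ultimately show "\<exists>a\<in>K i. \<exists>n::nat. b = a \<otimes>\<^bsub>G\<^esub> el 0 0 1 0 [^]\<^bsub>G\<^esub> n" by blast
    qed (auto simp: 1 intro: el_in_K)
  next
    case 2
    show ?thesis
    proof (rule bexI[of _ "el 1 0 0 0"], rule ballI)
      fix b assume "b \<in> K (Suc i)"
      then obtain x z where "b = el x 0 z 0" using 2 by (auto elim!: K_cases)
      moreover obtain n where "[x = int n] (mod int p)" using nat_rep by blast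
      ultimately have "b = el 0 0 z 0 \<otimes>\<^bsub>G\<^esub> el 1 0 0 0 [^]\<^bsub>G\<^esub> n"
        by (simp add: el_pow el_eq_iff)
      moreover have "el 0 0 z 0 \<in> K i" by (simp add: 2 el_in_K)
      ultimately show "\<exists>a\<in>K i. \<exists>n::nat. b = a \<otimes>\<^bsub>G\<^esub> el 1 0 0 0 [^]\<^bsub>G\<^esub> n" by blast
    qed (auto simp: 2 intro: el_in_K)
  next
    case 3
    show ?thesis
    proof (rule bexI[of _ "el 0 1 0 0"], rule ballI)
      fix b assume "b \<in> K (Suc i)"
      then obtain x y z where "b = el x y z 0" using 3 by (auto elim!: K_cases)
      moreover obtain n where n: "[y = int n] (mod int p)" using nat_rep by blast
      moreover have "[z - x * y + x * y = z - x * y + x * int n] (mod int p)"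
        by (intro cong_add cong_mult cong_refl n)
      ultimately have "b = el x 0 (z - x * y) 0 \<otimes>\<^bsub>G\<^esub> el 0 1 0 0 [^]\<^bsub>G\<^esub> n"
        by (simp add: el_pow el_eq_iff)
      moreover have "el x 0 (z - x * y) 0 \<in> K i" by (simp add: 3 el_in_K)
      ultimately show "\<exists>a\<in>K i. \<exists>n::nat. b = a \<otimes>\<^bsub>G\<^esub> el 0 1 0 0 [^]\<^bsub>G\<^esub> n" by blast
    qed (auto simp: 3 intro: el_in_K)
  next
    case 4
    show ?thesis
    proof (rule bexI[of _ "el 0 0 0 1"], rule ballI)
      fix b assume "b \<in> K (Suc i)"
      then obtain x y z k where "b = el x y z k" using 4 by (auto elim!: K_cases)
      then have "b = el x y z 0 \<otimes>\<^bsub>G\<^esub> el 0 0 0 1 [^]\<^bsub>G\<^esub> k" by (simp add: torus_pow)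
      moreover have "el x y z 0 \<in> K i" by (simp add: 4 el_in_K)
      ultimately show "\<exists>a\<in>K i. \<exists>n::nat. b = a \<otimes>\<^bsub>G\<^esub> el 0 0 0 1 [^]\<^bsub>G\<^esub> n" by blast
    qed (auto simp: 4 intro: el_in_K)
  qed
qed

end

section \<open>Infinitely many violators\<close>

lemma violator_for_prime:
  assumes "Factorial_Ring.prime p" "5 \<le> p"
  obtains P :: "nat monoid" and \<phi> where
    "extraspecial_plus p P"
    "\<phi> \<in> hom (integer_mod_group (p - 1)) (AutoGroup P)"
    "supersoluble (semidirect_product P (integer_mod_group (p - 1)) \<phi>)"
    "generative_ingleton_violator (semidirect_product P (integer_mod_group (p - 1)) \<phi>)"
    "order (semidirect_product P (integer_mod_group (p - 1)) \<phi>) = p ^ 3 * (p - 1)"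
proof -
  obtain g where "residue_primroot p g" using prime_primitive_root_exists[of p] assms by auto
  then interpret heisenberg_torus p g using assms by unfold_locales
  show thesis
    using that extraspecial_plus_P act_hom supersoluble_G violator order_G by blast
qed

lemma infinite_primes_ge_5: "infinite {p :: nat. Factorial_Ring.prime p \<and> 5 \<le> p}"
proof -
  have "{p :: nat. Factorial_Ring.prime p} - {..<5} \<subseteq> {p. Factorial_Ring.prime p \<and> 5 \<le> p}" by auto
  moreover have "infinite ({p :: nat. Factorial_Ring.prime p} - {..<5})"
    using primes_infinite by (simp add: Diff_infinite_finite)
  ultimately show ?thesis using infinite_super by blast
qed

theorem theorem1p2:
  shows "(\<exists>\<G> :: nat monoid set.
            infinite \<G> \<and>
            (\<forall>G\<in>\<G>. group G \<and> finite (carrier G) \<and> supersoluble G \<and> generative_ingleton_violator G) \<and>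
            (\<forall>G\<in>\<G>. \<forall>H\<in>\<G>. G \<noteq> H \<longrightarrow> \<not> G \<cong> H)) \<and>
         infinite {p :: nat. Factorial_Ring.prime p \<and> odd p \<and>
            (\<exists>(P :: nat monoid) \<phi>.
               extraspecial_plus p P \<and>
               \<phi> \<in> hom (integer_mod_group (p - 1)) (AutoGroup P) \<and>
               supersoluble (semidirect_product P (integer_mod_group (p - 1)) \<phi>) \<and>
               generative_ingleton_violator (semidirect_product P (integer_mod_group (p - 1)) \<phi>))}"
proof
  let ?primes = "{p :: nat. Factorial_Ring.prime p \<and> 5 \<le> p}"
  have "\<exists>H :: nat monoid. supersoluble H \<and> generative_ingleton_violator H \<and> order H = p ^ 3 * (p - 1)"
    if p: "p \<in> ?primes" for p
  proof -
    obtain P :: "nat monoid" and \<phi> where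
      ss: "supersoluble (semidirect_product P (integer_mod_group (p - 1)) \<phi>)"
      and v: "generative_ingleton_violator (semidirect_product P (integer_mod_group (p - 1)) \<phi>)"
      and o: "order (semidirect_product P (integer_mod_group (p - 1)) \<phi>) = p ^ 3 * (p - 1)"
      using p violator_for_prime[of p] by blast
    let ?G = "semidirect_product P (integer_mod_group (p - 1)) \<phi>"
    have "group ?G" using ss by (simp add: supersoluble_def)
    then obtain H :: "nat monoid" and h where H: "group H" "h \<in> iso ?G H"
      by (rule iso_nat_monoid)
    show ?thesis
      using supersoluble_iso[OF ss H] generative_ingleton_violator_iso[OF v H]
        iso_same_order[OF H(2)] o by metis
  qed
  then obtain F :: "nat \<Rightarrow> nat monoid" where F: "\<And>p. p \<in> ?primes \<Longrightarrow>
      supersoluble (F p) \<and> generative_ingleton_violator (F p) \<and> order (F p) = p ^ 3 * (p - 1)"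
    by metis
  \<comment> \<open>groups for distinct primes are told apart by their order\<close>
  have ord_less: "p ^ 3 * (p - 1) < q ^ 3 * (q - 1)" if "p < q" "5 \<le> p" for p q :: nat
    using that by (intro mult_strict_mono power_strict_mono) auto
  have ord_inj: "p = q" if "p \<in> ?primes" "q \<in> ?primes" "order (F p) = order (F q)" for p q
    using that F ord_less[of p q] ord_less[of q p] by (cases p q rule: linorder_cases) auto
  have "inj_on F ?primes" using ord_inj by (auto intro!: inj_onI)
  then have "infinite (F ` ?primes)" using infinite_primes_ge_5 finite_imageD by blast
  moreover have "\<forall>G\<in>F ` ?primes. group G \<and> finite (carrier G) \<and> supersoluble G \<and> generative_ingleton_violator G"
    using F by (auto simp: supersoluble_def)
  moreover have "\<forall>G\<in>F ` ?primes. \<forall>H\<in>F ` ?primes. G \<noteq> H \<longrightarrow> \<not> G \<cong> H"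
    using ord_inj iso_same_order unfolding is_iso_def by (auto, blast)
  ultimately show "\<exists>\<G> :: nat monoid set.
            infinite \<G> \<and>
            (\<forall>G\<in>\<G>. group G \<and> finite (carrier G) \<and> supersoluble G \<and> generative_ingleton_violator G) \<and>
            (\<forall>G\<in>\<G>. \<forall>H\<in>\<G>. G \<noteq> H \<longrightarrow> \<not> G \<cong> H)"
    by blast
next
  show "infinite {p :: nat. Factorial_Ring.prime p \<and> odd p \<and>
            (\<exists>(P :: nat monoid) \<phi>.
               extraspecial_plus p P \<and>
               \<phi> \<in> hom (integer_mod_group (p - 1)) (AutoGroup P) \<and>
               supersoluble (semidirect_product P (integer_mod_group (p - 1)) \<phi>) \<and>
               generative_ingleton_violator (semidirect_product P (integer_mod_group (p - 1)) \<phi>))}"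
    (is "infinite ?S")
  proof (rule infinite_super[OF _ infinite_primes_ge_5], rule subsetI)
    fix p :: nat assume "p \<in> {p. Factorial_Ring.prime p \<and> 5 \<le> p}"
    then have p: "Factorial_Ring.prime p" "5 \<le> p" by auto
    then have "odd p" by (intro prime_odd_nat) auto
    then show "p \<in> ?S" using p violator_for_prime[OF p] by blast
  qed
qed

end
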